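(* Let $A\in\mathbb{R}^{n\times n}$ be an invertible matrix and let $X_k\in\mathbb{R}^{n\times n}$ be a matrix. Put $F_k=I-AX_k$, $G_k=F_k^2$, and for $\alpha_k,\beta_k\in\mathbb{R}$ put $$X_{k+1}=X_k\big((\alpha_k+\beta_k)I+\beta_kF_k\big),\qquad F_{k+1}=I-AX_{k+1}.$$ Write $F_k=[f_{i,j}]$, $G_k=[g_{i,j}]$ and define $$B_0=n-\sum_{i=1}^n f_{i,i},\qquad B_1=n-\sum_{i=1}^n g_{i,i},$$ $$C_{00}=\sum_{i\neq j}f_{i,j}^2+\sum_{i=1}^n(f_{i,i}-1)^2,\qquad C_{11}=\sum_{i\neq j}g_{i,j}^2+\sum_{i=1}^n(g_{i,i}-1)^2,$$ $$C_{01}=C_{10}=\sum_{i\neq j}f_{i,j}g_{i,j}+\sum_{i=1}^n(f_{i,i}-1)(g_{i,i}-1).$$ If the linear system $$\begin{bmatrix}C_{00}&C_{01}\\ C_{10}&C_{11}\end{bmatrix}\begin{bmatrix}\alpha\\ \beta\end{bmatrix}=\begin{bmatrix}B_0\\ B_1\end{bmatrix}$$ is non-singular (i.e. $C_{00}C_{11}-C_{01}^2\neq0$), then $\min_{\alpha_k,\beta_k\in\mathbb{R}}\|F_{k+1}\|_F^2$ is achieved for $$\alpha_k=\frac{C_{11}B_0-C_{01}B_1}{C_{00}C_{11}-C_{01}^2},\qquad \beta_k=\frac{C_{00}B_1-C_{10}B_0}{C_{00}C_{11}-C_{01}^2}.$$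
   Context: $\|\cdot\|_F$ is the Frobenius norm on $\mathbb{R}^{n\times n}$; $I$ is the identity matrix of order $n$. *)

theory Defs
  imports "HOL-Analysis.Analysis"
begin

text \<open>The library norm on the iterated vector type \<^typ>\<open>real^'n^'n\<close> is the Frobenius norm
  (not the operator norm), as the following lemma records.\<close>

lemma norm_matrix_eq_frobenius:
  fixes M :: "real^'n^'n"
  shows "norm M = sqrt (\<Sum>i\<in>UNIV. \<Sum>j\<in>UNIV. (M $ i $ j)\<^sup>2)"
  by (simp add: norm_vec_def L2_set_def sum_nonneg)

definition residual :: "real^'n^'n \<Rightarrow> real^'n^'n \<Rightarrow> real^'n^'n" where
  "residual A X = mat 1 - A ** X"

definition next_iterate :: "real^'n^'n \<Rightarrow> real^'n^'n \<Rightarrow> real \<Rightarrow> real \<Rightarrow> real^'n^'n" where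
  "next_iterate A X \<alpha> \<beta> = X ** ((\<alpha> + \<beta>) *\<^sub>R mat 1 + \<beta> *\<^sub>R residual A X)"

end

theory Submission
  imports Defs
begin

text \<open>With \<open>P = F - I\<close> and \<open>Q = G - I\<close> the new residual is \<open>I + \<alpha> P + \<beta> Q\<close>, so minimising its
  Frobenius norm is a least-squares problem in two unknowns. The given linear system is the system
  of normal equations (its matrix is the Gram matrix of \<open>P\<close> and \<open>Q\<close>), and Cramer's rule gives
  the stated coefficients.\<close>

lemma norm_le_of_orthogonal_residual:
  fixes e p q :: "'a::real_inner"
  assumes "(e + a *\<^sub>R p + b *\<^sub>R q) \<bullet> p = 0" and "(e + a *\<^sub>R p + b *\<^sub>R q) \<bullet> q = 0"
  shows "norm (e + a *\<^sub>R p + b *\<^sub>R q) \<le> norm (e + x *\<^sub>R p + y *\<^sub>R q)"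
proof -
  define r where "r = e + a *\<^sub>R p + b *\<^sub>R q"
  \<comment> \<open>Any competitor differs from \<open>r\<close> by an element \<open>d\<close> of
    the span of \<open>p\<close> and \<open>q\<close>. Since \<open>r\<close> is orthogonal to that
    span, Pythagoras shows that adding \<open>d\<close> cannot shorten it.\<close>
  define d where "d = (x - a) *\<^sub>R p + (y - b) *\<^sub>R q"
  have "orthogonal r d"
    using assms unfolding r_def[symmetric] by (simp add: orthogonal_def d_def inner_add_right)
  then have "(norm (r + d))\<^sup>2 = (norm r)\<^sup>2 + (norm d)\<^sup>2"
    by (rule norm_add_Pythagorean)
  then have "norm r \<le> norm (r + d)"
    by (simp add: power2_le_imp_le)
  moreover have "r + d = e + x *\<^sub>R p + y *\<^sub>R q"
    by (simp add: r_def d_def algebra_simps)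
  ultimately show ?thesis
    unfolding r_def by metis
qed

text \<open>Orthogonality of the residual to \<open>p\<close> and to \<open>q\<close> gives two
  linear equations in \<open>a\<close> and \<open>b\<close>, with the Gram determinant
  \<open>D\<close> as determinant and right-hand sides \<open>- (e \<bullet> p)\<close> and
  \<open>- (e \<bullet> q)\<close>. The formulas for \<open>a\<close> and \<open>b\<close> are its
  solution.\<close>

lemma norm_le_Cramer:
  fixes e p q :: "'a::real_inner"
  defines "D \<equiv> (p \<bullet> p) * (q \<bullet> q) - (p \<bullet> q)\<^sup>2"
  assumes "D \<noteq> 0"
    and a: "a = ((p \<bullet> q) * (e \<bullet> q) - (q \<bullet> q) * (e \<bullet> p)) / D"
    and b: "b = ((p \<bullet> q) * (e \<bullet> p) - (p \<bullet> p) * (e \<bullet> q)) / D"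
  shows "norm (e + a *\<^sub>R p + b *\<^sub>R q) \<le> norm (e + x *\<^sub>R p + y *\<^sub>R q)"
proof (rule norm_le_of_orthogonal_residual)
  have aD: "a * D = (p \<bullet> q) * (e \<bullet> q) - (q \<bullet> q) * (e \<bullet> p)"
    and bD: "b * D = (p \<bullet> q) * (e \<bullet> p) - (p \<bullet> p) * (e \<bullet> q)"
    using \<open>D \<noteq> 0\<close> by (simp_all add: a b)
  \<comment> \<open>Multiplying by \<open>D\<close> clears the denominators of \<open>a\<close> and
    \<open>b\<close>, leaving a polynomial identity in the inner products;
    \<open>D \<noteq> 0\<close> then allows cancelling.\<close>
  have "D * ((e + a *\<^sub>R p + b *\<^sub>R q) \<bullet> p) = D * (e \<bullet> p) + (a * D) * (p \<bullet> p) + (b * D) * (p \<bullet> q)"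
    by (simp add: inner_commute[of q p] algebra_simps)
  also have "\<dots> = 0"
    unfolding aD bD by (simp add: D_def power2_eq_square algebra_simps)
  finally show "(e + a *\<^sub>R p + b *\<^sub>R q) \<bullet> p = 0"
    using \<open>D \<noteq> 0\<close> by simp
  have "D * ((e + a *\<^sub>R p + b *\<^sub>R q) \<bullet> q) = D * (e \<bullet> q) + (a * D) * (p \<bullet> q) + (b * D) * (q \<bullet> q)"
    by (simp add: algebra_simps)
  also have "\<dots> = 0"
    unfolding aD bD by (simp add: D_def power2_eq_square algebra_simps)
  finally show "(e + a *\<^sub>R p + b *\<^sub>R q) \<bullet> q = 0"
    using \<open>D \<noteq> 0\<close> by simp
qed

lemma matrix_diff_rdistrib:
  fixes A B :: "'a::ring_1^'n^'m"
  shows "(A - B) ** C = A ** C - B ** C"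
  by (simp add: vec_eq_iff matrix_matrix_mult_def left_diff_distrib sum_subtractf)

text \<open>Substituting \<open>A ** X = mat 1 - F\<close> leaves a polynomial in \<open>F\<close>
  alone. Its terms in \<beta> telescope: (I - F) + (F - F^2) = I - F^2. Hence the new residual is
  affine in \<alpha> and \<beta>.\<close>

lemma residual_next_iterate:
  fixes A X :: "real^'n^'n"
  assumes F: "F = residual A X"
  shows "residual A (next_iterate A X \<alpha> \<beta>)
    = mat 1 + \<alpha> *\<^sub>R (F - mat 1) + \<beta> *\<^sub>R (F ** F - mat 1)"
proof -
  have "A ** X = mat 1 - F"
    by (simp add: F residual_def)
  then have "A ** next_iterate A X \<alpha> \<beta> = (mat 1 - F) ** ((\<alpha> + \<beta>) *\<^sub>R mat 1 + \<beta> *\<^sub>R F)"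
    by (simp only: next_iterate_def F[symmetric] matrix_mul_assoc)
  also have "\<dots> = (\<alpha> + \<beta>) *\<^sub>R (mat 1 - F) + \<beta> *\<^sub>R (F - F ** F)"
    by (simp only: matrix_add_ldistrib matrix_scalar_ac scalar_matrix_assoc[symmetric]
        matrix_diff_rdistrib matrix_mul_lid matrix_mul_rid)
  finally have "residual A (next_iterate A X \<alpha> \<beta>)
    = mat 1 - ((\<alpha> + \<beta>) *\<^sub>R (mat 1 - F) + \<beta> *\<^sub>R (F - F ** F))"
    by (simp only: residual_def)
  then show ?thesis
    by (simp add: scaleR_diff_right scaleR_add_left)
qed

lemma sum_pairs_split_diagonal:
  fixes f :: "'n::finite \<Rightarrow> 'n \<Rightarrow> 'a::comm_monoid_add"
  shows "(\<Sum>i\<in>UNIV. \<Sum>j\<in>UNIV. f i j) = (\<Sum>(i, j)\<in>{(i, j). i \<noteq> j}. f i j) + (\<Sum>i\<in>UNIV. f i i)"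
proof -
  have "(\<Sum>i\<in>UNIV. \<Sum>j\<in>UNIV. f i j) = (\<Sum>(i, j)\<in>UNIV. f i j)"
    by (simp add: sum.cartesian_product)
  also have "\<dots> = (\<Sum>(i, j)\<in>{(i, j). i \<noteq> j}. f i j) + (\<Sum>(i, j)\<in>range (\<lambda>i. (i, i)). f i j)"
    by (subst sum.union_disjoint[symmetric]) (auto intro!: sum.cong)
  also have "(\<Sum>(i, j)\<in>range (\<lambda>i. (i, i)). f i j) = (\<Sum>i\<in>UNIV. f i i)"
    by (simp add: sum.reindex inj_on_def)
  finally show ?thesis .
qed

text \<open>The inner product on matrices is entrywise, and subtracting the identity alters only
  diagonal entries. This is the shape of \<open>C00\<close>, \<open>C01\<close> and
  \<open>C11\<close>.\<close>

lemma inner_matrix_minus_mat_1: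
  fixes M N :: "real^'n^'n"
  shows "(M - mat 1) \<bullet> (N - mat 1) = (\<Sum>(i, j)\<in>{(i, j). i \<noteq> j}. M $ i $ j * N $ i $ j)
    + (\<Sum>i\<in>UNIV. (M $ i $ i - 1) * (N $ i $ i - 1))"
  unfolding inner_vec_def sum_pairs_split_diagonal
  by (auto simp: mat_def intro!: arg_cong2[where f = "(+)"] sum.cong)

text \<open>Pairing with the identity keeps only the diagonal, so the value is a trace; it yields
  \<open>B0\<close> and \<open>B1\<close> up to sign.\<close>

lemma inner_mat_1_minus_mat_1:
  fixes M :: "real^'n^'n"
  shows "mat 1 \<bullet> (M - mat 1) = (\<Sum>i\<in>UNIV. M $ i $ i) - real CARD('n)"
  unfolding inner_vec_def sum_pairs_split_diagonal
  by (simp add: mat_def sum_subtractf sum.neutral case_prod_beta)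

theorem theorem2p1:
  fixes A X F G :: "real^'n^'n"
    and B0 B1 C00 C01 C10 C11 :: real
  assumes "invertible A"
    and "F = residual A X"
    and "G = F ** F"
    and "B0 = real CARD('n) - (\<Sum>i\<in>UNIV. F $ i $ i)"
    and "B1 = real CARD('n) - (\<Sum>i\<in>UNIV. G $ i $ i)"
    and "C00 = (\<Sum>(i, j)\<in>{(i, j). i \<noteq> j}. (F $ i $ j)\<^sup>2) + (\<Sum>i\<in>UNIV. (F $ i $ i - 1)\<^sup>2)"
    and "C11 = (\<Sum>(i, j)\<in>{(i, j). i \<noteq> j}. (G $ i $ j)\<^sup>2) + (\<Sum>i\<in>UNIV. (G $ i $ i - 1)\<^sup>2)"
    and "C01 = (\<Sum>(i, j)\<in>{(i, j). i \<noteq> j}. F $ i $ j * G $ i $ j)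
             + (\<Sum>i\<in>UNIV. (F $ i $ i - 1) * (G $ i $ i - 1))"
    and "C10 = C01"
    and "C00 * C11 - C01\<^sup>2 \<noteq> 0"
  shows "\<forall>\<alpha> \<beta>.
    (norm (residual A (next_iterate A X
        ((C11 * B0 - C01 * B1) / (C00 * C11 - C01\<^sup>2))
        ((C00 * B1 - C10 * B0) / (C00 * C11 - C01\<^sup>2)))))\<^sup>2
      \<le> (norm (residual A (next_iterate A X \<alpha> \<beta>)))\<^sup>2"
proof (intro allI)
  fix \<alpha> \<beta> :: real
  define P Q where "P = F - mat 1" and "Q = G - mat 1"
  have gram: "C00 = P \<bullet> P" "C11 = Q \<bullet> Q" "C01 = P \<bullet> Q"
    by (simp_all add: assms(6-8) P_def Q_def inner_matrix_minus_mat_1 power2_eq_square)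
  \<comment> \<open>These minus signs turn the stated numerators into those of
    \<open>norm_le_Cramer\<close> with \<open>e = mat 1\<close>.\<close>
  have rhs: "B0 = - (mat 1 \<bullet> P)" "B1 = - (mat 1 \<bullet> Q)"
    by (simp_all add: assms(4,5) P_def Q_def inner_mat_1_minus_mat_1)
  have res: "residual A (next_iterate A X a b) = mat 1 + a *\<^sub>R P + b *\<^sub>R Q" for a b
    by (simp add: residual_next_iterate[OF assms(2)] assms(3) P_def Q_def)
  show "(norm (residual A (next_iterate A X
        ((C11 * B0 - C01 * B1) / (C00 * C11 - C01\<^sup>2))
        ((C00 * B1 - C10 * B0) / (C00 * C11 - C01\<^sup>2)))))\<^sup>2
      \<le> (norm (residual A (next_iterate A X \<alpha> \<beta>)))\<^sup>2"
    unfolding res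
  proof (intro power_mono norm_le_Cramer)
    show "(P \<bullet> P) * (Q \<bullet> Q) - (P \<bullet> Q)\<^sup>2 \<noteq> 0"
      using assms(10) by (simp add: gram)
  qed (simp_all add: assms(9) gram rhs)
qed

end
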